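(* Let $R$ be a non-zero commutative ring and let $n$ be a positive integer. Then the matrix ring ${\rm M}_n(R)$ is a t-fine ring if and only if $R$ is a locally finite field.
   Context: Rings are associative with identity. A ring $S$ is t-fine if every non-zero element $a\in S$ can be written as $a=u+b$, where $u$ is a unit of $S$ of finite multiplicative order and $b$ is a nilpotent element of $S$ (no commutation required). A field is locally finite if each of its finitely generated subfields is finite (equivalently, it is algebraic over a finite field). *)

theory Defs
  imports
    "Jordan_Normal_Form.VS_Connect"
    "HOL-Algebra.Generated_Fields"
begin

definition nilpotent_elem :: "('a, 'm) ring_scheme \<Rightarrow> 'a \<Rightarrow> bool" where
  "nilpotent_elem S b \<longleftrightarrow> b \<in> carrier S \<and> (\<exists>m::nat. b [^]\<^bsub>S\<^esub> m = \<zero>\<^bsub>S\<^esub>)"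

definition torsion_unit :: "('a, 'm) ring_scheme \<Rightarrow> 'a \<Rightarrow> bool" where
  "torsion_unit S u \<longleftrightarrow> u \<in> Units S \<and> (\<exists>k::nat. k > 0 \<and> u [^]\<^bsub>S\<^esub> k = \<one>\<^bsub>S\<^esub>)"

definition t_fine_ring :: "('a, 'm) ring_scheme \<Rightarrow> bool" where
  "t_fine_ring S \<longleftrightarrow> ring S \<and>
     (\<forall>a \<in> carrier S. a \<noteq> \<zero>\<^bsub>S\<^esub> \<longrightarrow>
        (\<exists>u b. torsion_unit S u \<and> nilpotent_elem S b \<and> a = u \<oplus>\<^bsub>S\<^esub> b))"

definition locally_finite_field :: "('a, 'm) ring_scheme \<Rightarrow> bool" where
  "locally_finite_field F \<longleftrightarrow> field F \<and>
     (\<forall>H. finite H \<and> H \<subseteq> carrier F \<longrightarrow> finite (generate_field F H))"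

end

theory Submission
  imports Defs
begin

text \<open>
  If the scalar matrix $c$ is a sum $u + b$ with $u^k = 1$ and $b^m = 0$, then $u$ and $b$ commute
  because $c$ is central, so $c^k - 1 = c^k - u^k$ is a multiple of $b$ and is nilpotent. Hence every
  nonzero $c$ is a unit, and then $c^k = 1$. A field whose nonzero elements are all roots of unity
  is locally finite: the additive span of the finitely many monomials in a finite set is a finite
  ring, because the characteristic is positive.

  Conversely, units of matrices over a locally finite field are torsion, so it suffices to write every
  nonzero matrix over a field as a unit plus a nilpotent. Induct on the size, splitting off the first
  row and column: if the lower right block is $u + b$, subtract a nilpotent matrix with first row
  zero and lower right block $b$; its first column is free, and is chosen to make the Schur
  complement of $u$ nonzero.
\<close>

section \<open>Central elements that are a torsion unit plus a nilpotent\<close>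

text \<open>The cofactor \<open>g\<close> is required to commute with \<open>x \<ominus> y\<close>
  so that powers of their product split, which makes the product nilpotent as soon as
  \<open>x \<ominus> y\<close> is.\<close>

lemma (in ring) commuting_pow_diff_factor:
  assumes x: "x \<in> carrier R" and y: "y \<in> carrier R" and xy: "x \<otimes> y = y \<otimes> x"
  shows "\<exists>g \<in> carrier R. x [^] (k::nat) \<ominus> y [^] k = (x \<ominus> y) \<otimes> g \<and> (x \<ominus> y) \<otimes> g = g \<otimes> (x \<ominus> y)"
proof (induction k)
  case 0
  show ?case using x y by (intro bexI[of _ "\<zero>"]) (auto simp: minus_eq r_neg)
next
  case (Suc k)
  then obtain g where g: "g \<in> carrier R" and e: "x [^] k \<ominus> y [^] k = (x \<ominus> y) \<otimes> g"
    and c: "(x \<ominus> y) \<otimes> g = g \<otimes> (x \<ominus> y)" by blast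
  let ?d = "x \<ominus> y" and ?h = "g \<otimes> x \<oplus> y [^] k"
  have d: "?d \<in> carrier R" using x y by simp
  have p: "y [^] k \<in> carrier R" "x [^] k \<in> carrier R" using x y by simp_all
  have yk: "x \<otimes> y [^] k = y [^] k \<otimes> x"
    using group_commutes_pow[OF xy[symmetric] y x] by simp
  have yy: "y \<otimes> y [^] k = y [^] k \<otimes> y"
    using group_commutes_pow[OF refl y y] by simp
  have dx: "?d \<otimes> x = x \<otimes> ?d"
    using x y xy by (simp add: minus_eq l_distr r_distr l_minus r_minus)
  have dy: "?d \<otimes> y [^] k = y [^] k \<otimes> ?d"
    using x y p yk yy by (simp add: minus_eq l_distr r_distr l_minus r_minus)
  \<comment> \<open>Telescoping: the induction hypothesis factors the first summand, and moving
    \<open>y [^] k\<close> past \<open>x \<ominus> y\<close> the second, so the new cofactor is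
    \<open>?h\<close>.\<close>
  have "x [^] Suc k \<ominus> y [^] Suc k = (x [^] k \<ominus> y [^] k) \<otimes> x \<oplus> y [^] k \<otimes> (x \<ominus> y)"
    using x y p by (simp, algebra)
  also have "\<dots> = ?d \<otimes> ?h"
    using e dy d g x p by (simp add: r_distr m_assoc)
  finally have 1: "x [^] Suc k \<ominus> y [^] Suc k = ?d \<otimes> ?h" .
  have "?d \<otimes> (g \<otimes> x) = g \<otimes> ?d \<otimes> x"
    using c d g x by (simp flip: m_assoc)
  also have "\<dots> = g \<otimes> x \<otimes> ?d" using d g x dx by (simp add: m_assoc)
  finally have 2: "?d \<otimes> ?h = ?h \<otimes> ?d"
    using d g x p dy by (simp add: l_distr r_distr)
  show ?case using 1 2 g x p by (intro bexI[of _ ?h]) auto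
qed

lemma (in ring) central_torsion_plus_nilpotent:
  assumes s: "s \<in> carrier R" and central: "\<And>x. x \<in> carrier R \<Longrightarrow> s \<otimes> x = x \<otimes> s"
    and u: "torsion_unit R u" and b: "nilpotent_elem R b" and sub: "s = u \<oplus> b"
  shows "\<exists>(k :: nat) (m :: nat). k > 0 \<and> (s [^] k \<ominus> \<one>) [^] m = \<zero>"
proof -
  from u obtain k :: nat where k: "k > 0" "u [^] k = \<one>" and uc: "u \<in> carrier R"
    unfolding torsion_unit_def by auto
  from b obtain m :: nat where m: "b [^] m = \<zero>" and bc: "b \<in> carrier R"
    unfolding nilpotent_elem_def by auto
  have sb: "s \<ominus> u = b" using uc bc sub by algebra
  from commuting_pow_diff_factor[OF s uc central[OF uc], of k] obtain g where
    g: "g \<in> carrier R" "s [^] k \<ominus> \<one> = b \<otimes> g" "b \<otimes> g = g \<otimes> b"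
    unfolding sb k by blast
  have "(s [^] k \<ominus> \<one>) [^] m = b [^] m \<otimes> g [^] m"
    unfolding g(2) using pow_mult_distrib[OF g(3) bc g(1)] .
  then have "(s [^] k \<ominus> \<one>) [^] m = \<zero>" using m g(1) by simp
  then show ?thesis using k(1) by blast
qed

section \<open>Scalar matrices in a t-fine matrix ring\<close>

lemma smult_one_pow_mat: "(c \<cdot>\<^sub>m 1\<^sub>m n) ^\<^sub>m k = (c :: 'a :: comm_ring_1) ^ k \<cdot>\<^sub>m 1\<^sub>m n"
proof (induction k)
  case 0
  show ?case by (intro eq_matI) auto
next
  case (Suc k)
  have "(c ^ k \<cdot>\<^sub>m 1\<^sub>m n) * (c \<cdot>\<^sub>m 1\<^sub>m n) = (c ^ k * c) \<cdot>\<^sub>m 1\<^sub>m n"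
    by (intro eq_matI) (auto simp: mult_smult_assoc_mat[of _ n n _ n] mult_smult_distrib[of _ n n _ n])
  then show ?case by (simp add: Suc mult.commute)
qed

lemma t_fine_ring_mat_imp_root_of_unity_mod_nilpotents:
  fixes c :: "'a :: comm_ring_1"
  assumes n: "n > 0" and fine: "t_fine_ring (ring_mat TYPE('a) n ())" and c: "c \<noteq> 0"
  shows "\<exists>k m. k > 0 \<and> (c ^ k - 1) ^ m = 0"
proof -
  let ?S = "ring_mat TYPE('a) n ()"
  interpret S: ring ?S by (rule ring_mat)
  let ?s = "c \<cdot>\<^sub>m 1\<^sub>m n"
  have s: "?s \<in> carrier ?S" by (simp add: ring_mat_simps)
  have pow: "(d \<cdot>\<^sub>m 1\<^sub>m n) [^]\<^bsub>?S\<^esub> k = d ^ k \<cdot>\<^sub>m 1\<^sub>m n" for d :: 'a and k :: nat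
    by (subst pow_mat_ring_pow[symmetric]) (auto simp: smult_one_pow_mat)
  \<comment> \<open>The position \<open>(0,0)\<close> exists because \<open>n > 0\<close>. It
    separates the scalar matrix from zero here, and below it turns the final matrix identity into
    one in the base ring.\<close>
  have "?s $$ (0,0) \<noteq> 0\<^sub>m n n $$ (0,0)" using n c by auto
  then have "?s \<noteq> \<zero>\<^bsub>?S\<^esub>" by (metis ring_mat_simps(4))
  then obtain u b where "torsion_unit ?S u" "nilpotent_elem ?S b" "?s = u \<oplus>\<^bsub>?S\<^esub> b"
    using fine s unfolding t_fine_ring_def by blast
  moreover have "?s \<otimes>\<^bsub>?S\<^esub> x = x \<otimes>\<^bsub>?S\<^esub> ?s" if "x \<in> carrier ?S" for x
    using that by (simp add: ring_mat_simps mult_smult_assoc_mat[of _ n n _ n] mult_smult_distrib[of _ n n _ n])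
  ultimately obtain k m :: nat where k: "k > 0"
    and z: "(?s [^]\<^bsub>?S\<^esub> k \<ominus>\<^bsub>?S\<^esub> \<one>\<^bsub>?S\<^esub>) [^]\<^bsub>?S\<^esub> m = \<zero>\<^bsub>?S\<^esub>"
    using S.central_torsion_plus_nilpotent[OF s] by blast
  let ?t = "(c ^ k - 1) \<cdot>\<^sub>m 1\<^sub>m n"
  have t: "?t \<in> carrier ?S" by (simp add: ring_mat_simps)
  have "?s [^]\<^bsub>?S\<^esub> k = ?t \<oplus>\<^bsub>?S\<^esub> \<one>\<^bsub>?S\<^esub>"
    unfolding pow by (auto simp: ring_mat_simps intro!: eq_matI)
  then have "?s [^]\<^bsub>?S\<^esub> k \<ominus>\<^bsub>?S\<^esub> \<one>\<^bsub>?S\<^esub> = ?t"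
    using t by (simp add: S.minus_eq S.a_assoc S.r_neg)
  with z have "(c ^ k - 1) ^ m \<cdot>\<^sub>m 1\<^sub>m n = 0\<^sub>m n n" by (simp add: pow ring_mat_simps(4))
  then have "((c ^ k - 1) ^ m \<cdot>\<^sub>m 1\<^sub>m n) $$ (0,0) = (0\<^sub>m n n :: 'a mat) $$ (0,0)" by simp
  then show ?thesis using k n by auto
qed

section \<open>Commutative rings whose nonzero elements are roots of unity\<close>

text \<open>Modulo \<open>d\<close> the relation \<open>(d ^ k - 1) ^ m = 0\<close> reads
  \<open>(- 1) ^ m = 0\<close>, so every nonzero \<open>d\<close> is a unit. A nonzero
  \<open>c ^ k - 1\<close> would then be both a unit and nilpotent.\<close>

lemma roots_of_unity_mod_nilpotents_imp_roots_of_unity: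
  fixes c :: "'a :: comm_ring_1"
  assumes H: "\<And>c :: 'a. c \<noteq> 0 \<Longrightarrow> \<exists>k m. k > 0 \<and> (c ^ k - 1) ^ m = 0" and c: "c \<noteq> 0"
  shows "\<exists>k>0. c ^ k = 1"
proof -
  have unit: "d dvd 1" if d: "d \<noteq> 0" for d :: 'a
  proof -
    from H[OF d] obtain k m where k: "k > 0" and m: "(d ^ k - 1) ^ m = 0" by blast
    \<comment> \<open>A difference divides the difference of the \<open>m\<close>-th powers, here
      for \<open>d ^ k - 1\<close> and \<open>- 1\<close>, whose difference is
      \<open>d ^ k\<close>.\<close>
    have "d dvd (d ^ k - 1) ^ m - (- 1) ^ m"
    proof -
      have "d ^ k - 1 - (- 1) dvd (d ^ k - 1) ^ m - (- 1) ^ m"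
        by (subst power_diff_sumr2) simp
      moreover have "d dvd d ^ k" using k by (simp add: dvd_power)
      ultimately show ?thesis by (auto intro: dvd_trans)
    qed
    then have "d dvd - ((- 1) ^ m)" using m by simp
    then have "d dvd (- 1) ^ m * (- 1) ^ m" by (metis dvd_minus_iff dvd_mult)
    moreover have "((- 1) ^ m * (- 1) ^ m :: 'a) = 1"
      by (simp flip: power_mult_distrib)
    ultimately show ?thesis by metis
  qed
  from H[OF c] obtain k m where k: "k > 0" and m: "(c ^ k - 1) ^ m = 0" by blast
  have "c ^ k - 1 = 0"
  proof (rule ccontr)
    assume "c ^ k - 1 \<noteq> 0"
    from dvd_power_same[OF unit[OF this], of m] m have "0 dvd (1 :: 'a)" by simp
    then show False by simp
  qed
  then show ?thesis using k by auto
qed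

lemma finite_subring_generated:
  fixes H :: "'a :: comm_ring_1 set"
  assumes roots: "\<And>c :: 'a. c \<noteq> 0 \<Longrightarrow> \<exists>k>0. c ^ k = 1" and fin: "finite H"
  obtains K where "finite K" "H \<subseteq> K" "1 \<in> K" "\<And>x. x \<in> K \<Longrightarrow> - x \<in> K"
    "\<And>x y. x \<in> K \<Longrightarrow> y \<in> K \<Longrightarrow> x + y \<in> K" "\<And>x y. x \<in> K \<Longrightarrow> y \<in> K \<Longrightarrow> x * y \<in> K"
proof -
  \<comment> \<open>Only nonzero elements have an order; \<open>0\<close> is recovered at the end as
    an element of \<open>K\<close>.\<close>
  define H' where "H' = H - {0}"
  define M where "M = {\<Prod>h\<in>H'. h ^ e h | e :: 'a \<Rightarrow> nat. True}"
  \<comment> \<open>Natural coefficients suffice for a subring: with a positive \<open>N\<close>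
    such that \<open>of_nat N = 0\<close>, the element \<open>- 1\<close> is
    \<open>of_nat (N - 1)\<close>.\<close>
  define K where "K = {\<Sum>x\<in>M. of_nat (c x) * x | c :: 'a \<Rightarrow> nat. True}"
  have finH: "finite H'" using fin by (simp add: H'_def)
  obtain ord where ord: "\<And>h. h \<in> H' \<Longrightarrow> ord h > 0 \<and> h ^ ord h = 1"
    using roots unfolding H'_def by (metis Diff_iff singletonI)
  have finM: "finite M"
  proof -
    \<comment> \<open>Exponents may be reduced modulo the orders, so finitely many exponent
      functions produce all monomials.\<close>
    have "M \<subseteq> (\<lambda>e. \<Prod>h\<in>H'. h ^ e h) ` (\<Pi>\<^sub>E h\<in>H'. {..<ord h})"
    proof
      fix x assume "x \<in> M"
      then obtain e where x: "x = (\<Prod>h\<in>H'. h ^ e h)" unfolding M_def by blast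
      have red: "h ^ e h = h ^ (e h mod ord h)" if "h \<in> H'" for h
        using ord[OF that] by (metis div_mult_mod_eq mult.commute power_add power_mult power_one mult_1)
      have "x = (\<Prod>h\<in>H'. h ^ (restrict (\<lambda>h. e h mod ord h) H') h)"
        unfolding x by (rule prod.cong) (use red in auto)
      then show "x \<in> (\<lambda>e. \<Prod>h\<in>H'. h ^ e h) ` (\<Pi>\<^sub>E h\<in>H'. {..<ord h})"
        using ord by (intro image_eqI[of _ _ "restrict (\<lambda>h. e h mod ord h) H'"]) auto
    qed
    moreover have "finite (\<Pi>\<^sub>E h\<in>H'. {..<ord h})" using finH by (intro finite_PiE) auto
    ultimately show ?thesis by (meson finite_imageI finite_subset)
  qed
  have M1: "1 \<in> M" unfolding M_def by (intro CollectI exI[of _ "\<lambda>_. 0"]) simp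
  have HM: "h \<in> M" if "h \<in> H'" for h
  proof -
    have "(\<Prod>g\<in>H'. g ^ (if g = h then 1 else 0)) = (\<Prod>g\<in>H'. if g = h then g else 1)"
      by (rule prod.cong) auto
    also have "\<dots> = h" using finH that by (simp add: prod.delta)
    finally show ?thesis unfolding M_def by (intro CollectI exI[of _ "\<lambda>g. if g = h then 1 else 0"]) simp
  qed
  have MM: "x * y \<in> M" if xy: "x \<in> M" "y \<in> M" for x y
  proof -
    from xy obtain e f where "x = (\<Prod>h\<in>H'. h ^ e h)" "y = (\<Prod>h\<in>H'. h ^ f h)"
      unfolding M_def by blast
    then have "x * y = (\<Prod>h\<in>H'. h ^ (e h + f h))" by (simp add: power_add prod.distrib)
    then show ?thesis unfolding M_def by (intro CollectI exI[of _ "\<lambda>h. e h + f h"]) simp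
  qed
  \<comment> \<open>The characteristic is positive: either \<open>2 = 0\<close>, or \<open>2\<close>
    is a root of unity and \<open>2 ^ k - 1\<close> vanishes in the ring.\<close>
  obtain N :: nat where N: "N > 0" "of_nat N = (0 :: 'a)"
  proof (cases "(2 :: 'a) = 0")
    case True
    then show ?thesis using that[of 2] by simp
  next
    case False
    from roots[OF this] obtain k where k: "k > 0" "(2 :: 'a) ^ k = 1" by blast
    have "(1 :: nat) < 2 ^ k" using k(1) by (intro one_less_power) auto
    moreover from this have "of_nat (2 ^ k - 1) = (2 :: 'a) ^ k - 1" by (subst of_nat_diff) auto
    ultimately show ?thesis using that[of "2 ^ k - 1"] k by simp
  qed
  have modN: "of_nat (a mod N) = (of_nat a :: 'a)" for a
  proof -
    have "(of_nat a :: 'a) = of_nat (a div N * N + a mod N)" by simp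
    also have "\<dots> = of_nat (a mod N)" by (simp only: of_nat_add of_nat_mult N(2)) simp
    finally show ?thesis by simp
  qed
  have finK: "finite K"
  proof -
    have "K \<subseteq> (\<lambda>c. \<Sum>x\<in>M. of_nat (c x) * x) ` (\<Pi>\<^sub>E x\<in>M. {..<N})"
    proof
      fix x assume "x \<in> K"
      then obtain c where x: "x = (\<Sum>m\<in>M. of_nat (c m) * m)" unfolding K_def by blast
      have "x = (\<Sum>m\<in>M. of_nat (restrict (\<lambda>m. c m mod N) M m) * m)"
        unfolding x by (rule sum.cong) (auto simp: modN)
      then show "x \<in> (\<lambda>c. \<Sum>x\<in>M. of_nat (c x) * x) ` (\<Pi>\<^sub>E x\<in>M. {..<N})"
        using N by (intro image_eqI[of _ _ "restrict (\<lambda>m. c m mod N) M"]) auto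
    qed
    moreover have "finite (\<Pi>\<^sub>E x\<in>M. {..<N})" using finM by (intro finite_PiE) auto
    ultimately show ?thesis by (meson finite_imageI finite_subset)
  qed
  have K0: "0 \<in> K" unfolding K_def by (intro CollectI exI[of _ "\<lambda>_. 0"]) simp
  have MK: "m \<in> K" if "m \<in> M" for m
  proof -
    have "(\<Sum>x\<in>M. of_nat (if x = m then 1 else 0) * x) = (\<Sum>x\<in>M. if x = m then x else 0)"
      by (rule sum.cong) auto
    also have "\<dots> = m" using finM that by (simp add: sum.delta)
    finally show ?thesis unfolding K_def by (intro CollectI exI[of _ "\<lambda>x. if x = m then 1 else 0"]) simp
  qed
  have Kadd: "x + y \<in> K" if xy: "x \<in> K" "y \<in> K" for x y
  proof -
    from xy obtain c d where "x = (\<Sum>m\<in>M. of_nat (c m) * m)" "y = (\<Sum>m\<in>M. of_nat (d m) * m)"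
      unfolding K_def by blast
    then have "x + y = (\<Sum>m\<in>M. of_nat (c m + d m) * m)" by (simp add: distrib_right sum.distrib)
    then show ?thesis unfolding K_def by (intro CollectI exI[of _ "\<lambda>h. c h + d h"]) simp
  qed
  have Kscale: "of_nat a * x \<in> K" if "x \<in> K" for x a
    using that by (induction a) (auto simp: K0 Kadd distrib_right)
  have Ksum: "sum f A \<in> K" if "\<And>i. i \<in> A \<Longrightarrow> f i \<in> K" for f :: "'a \<Rightarrow> 'a" and A
    using that by (induction A rule: infinite_finite_induct) (auto simp: K0 Kadd)
  have Kmult: "x * y \<in> K" if xy: "x \<in> K" "y \<in> K" for x y
  proof -
    from xy obtain c d where "x = (\<Sum>m\<in>M. of_nat (c m) * m)" "y = (\<Sum>m\<in>M. of_nat (d m) * m)"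
      unfolding K_def by blast
    then have "x * y = (\<Sum>m\<in>M. \<Sum>l\<in>M. of_nat (c m * d l) * (m * l))"
      by (simp add: sum_product algebra_simps)
    then show ?thesis by (simp only:) (intro Ksum Kscale MK MM)
  qed
  have Kneg: "- x \<in> K" if "x \<in> K" for x
  proof -
    have "(of_nat (N - 1) :: 'a) = - 1" using N by (simp add: of_nat_diff)
    then have "- x = of_nat (N - 1) * x" by simp
    then show ?thesis using Kscale[OF that] by simp
  qed
  have "H \<subseteq> K" using HM MK K0 unfolding H'_def by blast
  then show ?thesis using that[of K] finK MK[OF M1] Kneg Kadd Kmult by blast
qed

lemma inv_class_ringI:
  assumes "x * y = (1 :: 'a :: comm_ring_1)"
  shows "inv\<^bsub>class_ring\<^esub> x = y"
  using class_cring.comm_inv_char[of x y] assms by simp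

text \<open>If \<open>c ^ k = 1\<close> with \<open>k > 0\<close>, then \<open>c ^ (k - 1)\<close>
  is the inverse of \<open>c\<close>. So the finite subring around \<open>H\<close> is closed under
  inverses of its nonzero elements and contains the generated field.\<close>

lemma roots_of_unity_imp_locally_finite_field:
  assumes roots: "\<And>c :: 'a :: comm_ring_1. c \<noteq> 0 \<Longrightarrow> \<exists>k>0. c ^ k = 1"
  shows "locally_finite_field (class_ring :: 'a ring)"
proof -
  have pinv: "c * c ^ (k - 1) = 1" if "k > 0" "c ^ k = 1" for c :: 'a and k
    using that by (metis power_eq_if less_numeral_extra(3))
  have unit: "\<exists>d. c * d = 1" if "c \<noteq> 0" for c :: 'a
    using roots[OF that] pinv by blast
  have "field (class_ring :: 'a ring)"
  proof (rule cring.cring_fieldI[OF class_cring.is_cring])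
    show "Units (class_ring :: 'a ring) = carrier class_ring - {\<zero>\<^bsub>class_ring\<^esub>}"
      using unit by (fastforce simp: Units_def mult.commute)
  qed
  moreover have "finite (generate_field (class_ring :: 'a ring) H)" if fin: "finite H" for H
  proof -
    obtain K :: "'a set" where K: "finite K" "H \<subseteq> K" "1 \<in> K" "\<And>x. x \<in> K \<Longrightarrow> - x \<in> K"
      "\<And>x y. x \<in> K \<Longrightarrow> y \<in> K \<Longrightarrow> x + y \<in> K" "\<And>x y. x \<in> K \<Longrightarrow> y \<in> K \<Longrightarrow> x * y \<in> K"
      using finite_subring_generated[OF roots fin] by blast
    have pow: "x ^ k \<in> K" if "x \<in> K" for x k
      using that by (induction k) (auto simp: K)
    have "x \<in> K" if "x \<in> generate_field (class_ring :: 'a ring) H" for x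
      using that
    proof (induction rule: generate_field.induct)
      case (m_inv h)
      then obtain k where "k > 0" "h ^ k = 1" using roots[of h] by auto
      then have "inv\<^bsub>class_ring\<^esub> h = h ^ (k - 1)" by (intro inv_class_ringI pinv)
      then show ?case using pow m_inv by simp
    qed (use K in \<open>auto simp: class_ring_simps\<close>)
    then show ?thesis using K(1) by (meson finite_subset subsetI)
  qed
  ultimately show ?thesis unfolding locally_finite_field_def by blast
qed

section \<open>Sums of a unit and a nilpotent: conjugation and transposition\<close>

definition fine_elem :: "('a, 'm) ring_scheme \<Rightarrow> 'a \<Rightarrow> bool" where
  "fine_elem S a \<longleftrightarrow> (\<exists>u b. u \<in> Units S \<and> nilpotent_elem S b \<and> a = u \<oplus>\<^bsub>S\<^esub> b)"

text \<open>Conjugation maps units to units, and the powers of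
  \<open>q \<otimes> b \<otimes> p\<close> are the conjugated powers of \<open>b\<close>. This
  allows passing to a conjugate with better blocks.\<close>

lemma (in ring) fine_elem_conj:
  assumes p: "p \<in> carrier R" and q: "q \<in> carrier R" and pq: "p \<otimes> q = \<one>" and qp: "q \<otimes> p = \<one>"
    and a: "a \<in> carrier R" and fine: "fine_elem R (p \<otimes> a \<otimes> q)"
  shows "fine_elem R a"
proof -
  from fine obtain u b and m :: nat where u: "u \<in> Units R" and b: "b \<in> carrier R" "b [^] m = \<zero>"
    and e: "p \<otimes> a \<otimes> q = u \<oplus> b"
    unfolding fine_elem_def nilpotent_elem_def by blast
  have uc: "u \<in> carrier R" using u by auto
  have units: "p \<in> Units R" "q \<in> Units R" using p q pq qp unfolding Units_def by auto
  have pqx: "p \<otimes> (q \<otimes> x) = x" and qpx: "q \<otimes> (p \<otimes> x) = x" if "x \<in> carrier R" for x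
    using p q pq qp that by (simp_all flip: m_assoc)
  have "(q \<otimes> b \<otimes> p) [^] k = q \<otimes> b [^] k \<otimes> p" for k :: nat
    by (induction k) (use p q b qp in \<open>simp_all add: m_assoc pqx\<close>)
  then have "nilpotent_elem R (q \<otimes> b \<otimes> p)"
    unfolding nilpotent_elem_def using b p q by (auto intro!: exI[of _ m])
  moreover have "q \<otimes> u \<otimes> p \<in> Units R" using units u by simp
  moreover have "a = q \<otimes> u \<otimes> p \<oplus> q \<otimes> b \<otimes> p"
  proof -
    have "a = q \<otimes> (p \<otimes> a \<otimes> q) \<otimes> p" using p q a qp by (simp add: m_assoc qpx)
    then show ?thesis unfolding e using p q uc b by (simp add: l_distr r_distr)
  qed
  ultimately show ?thesis unfolding fine_elem_def by blast
qed

abbreviation fine_mat :: "nat \<Rightarrow> 'a :: comm_ring_1 mat \<Rightarrow> bool" where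
  "fine_mat n A \<equiv> fine_elem (ring_mat TYPE('a) n ()) A"

lemma mat_UnitsI:
  fixes U :: "'a :: comm_ring_1 mat"
  assumes "U \<in> carrier_mat n n" "V \<in> carrier_mat n n" "U * V = 1\<^sub>m n" "V * U = 1\<^sub>m n"
  shows "U \<in> Units (ring_mat TYPE('a) n ())"
  using assms unfolding Units_def by (auto simp: ring_mat_simps)

lemma mat_UnitsE:
  fixes U :: "'a :: comm_ring_1 mat"
  assumes "U \<in> Units (ring_mat TYPE('a) n ())"
  obtains V where "U \<in> carrier_mat n n" "V \<in> carrier_mat n n" "U * V = 1\<^sub>m n" "V * U = 1\<^sub>m n"
  using assms unfolding Units_def by (auto simp: ring_mat_simps)

lemma nilpotent_elem_mat_iff:
  fixes B :: "'a :: comm_ring_1 mat"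
  shows "nilpotent_elem (ring_mat TYPE('a) n ()) B \<longleftrightarrow> B \<in> carrier_mat n n \<and> (\<exists>m. B ^\<^sub>m m = 0\<^sub>m n n)"
  unfolding nilpotent_elem_def ring_mat_simps by (auto simp: pow_mat_ring_pow[where b = "()"])

lemma transpose_pow_mat:
  fixes B :: "'a :: comm_ring_1 mat"
  assumes B: "B \<in> carrier_mat n n"
  shows "transpose_mat (B ^\<^sub>m k) = transpose_mat B ^\<^sub>m k"
proof (induction k)
  case (Suc k)
  \<comment> \<open>Transposition reverses products, so the new factor is first moved to the
    left.\<close>
  have "B ^\<^sub>m k * B = B * B ^\<^sub>m k"
  proof (induction k)
    case (Suc k)
    then show ?case using B by (metis assoc_mult_mat pow_carrier_mat pow_mat.simps(2))
  qed (use B in simp)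
  then have "transpose_mat (B ^\<^sub>m Suc k) = transpose_mat (B * B ^\<^sub>m k)" by simp
  also have "\<dots> = transpose_mat (B ^\<^sub>m k) * transpose_mat B"
    by (rule transpose_mult) (use B in auto)
  finally show ?case using Suc by simp
qed (use B in simp)

text \<open>Transposition preserves units and nilpotents; it reduces the case of a nonzero first
  column to that of a nonzero first row.\<close>

lemma fine_mat_transpose:
  fixes A :: "'a :: comm_ring_1 mat"
  assumes "fine_mat n (transpose_mat A)"
  shows "fine_mat n A"
proof -
  from assms obtain U N where U: "U \<in> Units (ring_mat TYPE('a) n ())"
    and N: "nilpotent_elem (ring_mat TYPE('a) n ()) N" and A: "transpose_mat A = U + N"
    unfolding fine_elem_def ring_mat_simps by blast
  from U obtain V where UV: "U \<in> carrier_mat n n" "V \<in> carrier_mat n n" "U * V = 1\<^sub>m n" "V * U = 1\<^sub>m n"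
    by (rule mat_UnitsE)
  from N obtain m where Nm: "N \<in> carrier_mat n n" "N ^\<^sub>m m = 0\<^sub>m n n"
    unfolding nilpotent_elem_mat_iff by blast
  have "transpose_mat U \<in> Units (ring_mat TYPE('a) n ())"
    by (rule mat_UnitsI[of _ _ "transpose_mat V"])
      (use UV in \<open>simp_all flip: transpose_mult[of _ n n _ n] add: transpose_one\<close>)
  moreover have "nilpotent_elem (ring_mat TYPE('a) n ()) (transpose_mat N)"
    unfolding nilpotent_elem_mat_iff using Nm transpose_pow_mat[OF Nm(1), of m]
    by (auto intro!: exI[of _ m])
  moreover have "A = transpose_mat U + transpose_mat N"
    using A transpose_add[OF UV(1) Nm(1)] by (metis transpose_transpose)
  ultimately show ?thesis unfolding fine_elem_def ring_mat_simps by blast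
qed

section \<open>Nilpotent and invertible block matrices\<close>

lemma block_nilpotent:
  fixes B :: "'a :: comm_ring_1 mat"
  assumes B: "B \<in> carrier_mat m m" "B ^\<^sub>m k = 0\<^sub>m m m" and z: "z \<in> carrier_mat m 1"
  shows "nilpotent_elem (ring_mat TYPE('a) (1 + m) ()) (four_block_mat (0\<^sub>m 1 1) (0\<^sub>m 1 m) z B)"
proof -
  let ?N = "four_block_mat (0\<^sub>m 1 1) (0\<^sub>m 1 m) z B"
  \<comment> \<open>The column block lags one power of \<open>B\<close> behind the lower right
    block, so the power \<open>Suc k\<close> is the one shown to vanish.\<close>
  have "?N ^\<^sub>m Suc j = four_block_mat (0\<^sub>m 1 1) (0\<^sub>m 1 m) (B ^\<^sub>m j * z) (B ^\<^sub>m Suc j)" for j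
  proof (induction j)
    case (Suc j)
    have "?N ^\<^sub>m Suc (Suc j) = four_block_mat (0\<^sub>m 1 1) (0\<^sub>m 1 m) (B ^\<^sub>m j * z) (B ^\<^sub>m Suc j) * ?N"
      using Suc by simp
    also have "\<dots> = four_block_mat (0\<^sub>m 1 1 * 0\<^sub>m 1 1 + 0\<^sub>m 1 m * z) (0\<^sub>m 1 1 * 0\<^sub>m 1 m + 0\<^sub>m 1 m * B)
       (B ^\<^sub>m j * z * 0\<^sub>m 1 1 + B ^\<^sub>m Suc j * z) (B ^\<^sub>m j * z * 0\<^sub>m 1 m + B ^\<^sub>m Suc j * B)"
      by (rule mult_four_block_mat) (use B z in \<open>auto intro!: mult_carrier_mat\<close>)
    also have "\<dots> = four_block_mat (0\<^sub>m 1 1) (0\<^sub>m 1 m) (B ^\<^sub>m Suc j * z) (B ^\<^sub>m Suc (Suc j))"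
      by (rule cong_four_block_mat) (use B z in \<open>auto intro!: eq_matI\<close>)
    finally show ?case .
  qed (use B z in auto)
  from this[of k] have "?N ^\<^sub>m Suc k = 0\<^sub>m (1 + m) (1 + m)" using B z by simp
  moreover have "?N \<in> carrier_mat (1 + m) (1 + m)" using B z by auto
  ultimately show ?thesis unfolding nilpotent_elem_mat_iff by blast
qed

lemma uminus_zero_mat [simp]: "- 0\<^sub>m k m = (0\<^sub>m k m :: 'a :: group_add mat)"
  by (intro eq_matI) auto

lemma uminus_r_inv_mat:
  fixes A :: "'a :: group_add mat"
  shows "A \<in> carrier_mat k m \<Longrightarrow> A + - A = 0\<^sub>m k m"
  by (intro eq_matI) auto

lemma block_lower_triangular_unit:
  fixes S U :: "'a :: comm_ring_1 mat"
  assumes S: "S \<in> Units (ring_mat TYPE('a) l ())" and U: "U \<in> Units (ring_mat TYPE('a) m ())"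
    and w: "w \<in> carrier_mat m l"
  shows "four_block_mat S (0\<^sub>m l m) w U \<in> Units (ring_mat TYPE('a) (l + m) ())"
proof -
  from S obtain S' where S: "S \<in> carrier_mat l l" "S' \<in> carrier_mat l l" "S * S' = 1\<^sub>m l" "S' * S = 1\<^sub>m l"
    by (rule mat_UnitsE)
  from U obtain V where U: "U \<in> carrier_mat m m" "V \<in> carrier_mat m m" "U * V = 1\<^sub>m m" "V * U = 1\<^sub>m m"
    by (rule mat_UnitsE)
  \<comment> \<open>The inverse is again block lower triangular; this block solves
    \<open>w * S' + U * ?w = 0\<close>.\<close>
  let ?w = "- (V * w * S')"
  have Vw: "V * w \<in> carrier_mat m l" using U w by simp
  have w': "?w \<in> carrier_mat m l" using U w S by auto
  have 1: "w * S' + U * ?w = 0\<^sub>m m l"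
  proof -
    have wS: "w * S' \<in> carrier_mat m l" using w S by simp
    have "U * (V * w * S') = U * V * (w * S')"
      unfolding assoc_mult_mat[OF U(2) w S(2)] assoc_mult_mat[OF U(1,2) wS] ..
    then have "U * (V * w * S') = w * S'" using U(3) left_mult_one_mat[OF wS] by simp
    moreover have "U * ?w = - (U * (V * w * S'))" using U w S Vw by simp
    ultimately show ?thesis using w S by (auto intro!: eq_matI)
  qed
  have 2: "?w * S + V * w = 0\<^sub>m m l"
  proof -
    have "V * w * S' * S = V * w"
      unfolding assoc_mult_mat[OF Vw S(2,1)] S(4) by (rule right_mult_one_mat[OF Vw])
    moreover have "?w * S = - (V * w * S' * S)" using U w S Vw by simp
    ultimately show ?thesis using Vw by (auto intro!: eq_matI)
  qed
  have 3: "four_block_mat S (0\<^sub>m l m) w U * four_block_mat S' (0\<^sub>m l m) ?w V = 1\<^sub>m (l + m)"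
    by (subst mult_four_block_mat[of _ l l _ m _ m _ _ l _ m], insert S U w w' 1, auto)
  have 4: "four_block_mat S' (0\<^sub>m l m) ?w V * four_block_mat S (0\<^sub>m l m) w U = 1\<^sub>m (l + m)"
    by (subst mult_four_block_mat[of _ l l _ m _ m _ _ l _ m], insert S U w w' 2, auto)
  show ?thesis
    by (rule mat_UnitsI[OF _ _ 3 4]) (use S U w w' in auto)
qed

text \<open>\<open>S\<close> is the Schur complement of \<open>U\<close>. The matrix factors as the
  block upper unitriangular matrix with corner \<open>x * V\<close> times the block lower triangular
  matrix with blocks \<open>S\<close>, \<open>w\<close>, \<open>U\<close>.\<close>

lemma block_unit:
  fixes a x w U V :: "'a :: comm_ring_1 mat"
  assumes a: "a \<in> carrier_mat l l" and x: "x \<in> carrier_mat l m" and w: "w \<in> carrier_mat m l"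
    and U: "U \<in> carrier_mat m m" and V: "V \<in> carrier_mat m m" and UV: "U * V = 1\<^sub>m m" "V * U = 1\<^sub>m m"
    and S: "S \<in> Units (ring_mat TYPE('a) l ())" and aS: "a = S + x * V * w"
  shows "four_block_mat a x w U \<in> Units (ring_mat TYPE('a) (l + m) ())"
proof -
  interpret R: ring "ring_mat TYPE('a) (l + m) ()" by (rule ring_mat)
  have Sc: "S \<in> carrier_mat l l" using S by (rule mat_UnitsE)
  let ?P = "\<lambda>t. four_block_mat (1\<^sub>m l) t (0\<^sub>m m l) (1\<^sub>m m)"
  have xV: "x * V \<in> carrier_mat l m" using x V by simp
  have PP: "?P s * ?P t = ?P (t + s)" if "s \<in> carrier_mat l m" "t \<in> carrier_mat l m" for s t :: "'a mat"
    by (subst mult_four_block_mat[of _ l l _ m _ m _ _ l _ m], insert that, auto)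
  have "?P (x * V) \<in> Units (ring_mat TYPE('a) (l + m) ())"
    by (rule mat_UnitsI[of _ _ "?P (- (x * V))"])
      (use xV in \<open>simp_all add: PP uminus_l_inv_mat uminus_r_inv_mat\<close>)
  moreover have "four_block_mat S (0\<^sub>m l m) w U \<in> Units (ring_mat TYPE('a) (l + m) ())"
    by (rule block_lower_triangular_unit[OF S mat_UnitsI[OF U V UV] w])
  ultimately have "?P (x * V) * four_block_mat S (0\<^sub>m l m) w U \<in> Units (ring_mat TYPE('a) (l + m) ())"
    using R.Units_m_closed unfolding ring_mat_simps by blast
  moreover have "?P (x * V) * four_block_mat S (0\<^sub>m l m) w U = four_block_mat a x w U"
  proof -
    have "x * V * U = x" using x V U UV by (simp add: assoc_mult_mat[of _ l m _ m])
    then show ?thesis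
      by (subst mult_four_block_mat[of _ l l _ m _ m _ _ l _ m], insert Sc a x w U xV aS, auto)
  qed
  ultimately show ?thesis by simp
qed


section \<open>Rows and columns over a field\<close>

text \<open>The assumption \<open>unit\<close> makes the ring a field while the type class stays
  \<open>comm_ring_1\<close>. A solution is supported at one position where \<open>x\<close> is
  nonzero, hence invertible.\<close>

lemma mult_row_mat_column_solvable:
  fixes x r :: "'a :: comm_ring_1 mat"
  assumes unit: "\<And>c :: 'a. c \<noteq> 0 \<Longrightarrow> c dvd 1"
    and x: "x \<in> carrier_mat 1 m" "x \<noteq> 0\<^sub>m 1 m" and r: "r \<in> carrier_mat 1 1"
  shows "\<exists>w \<in> carrier_mat m 1. x * w = r"
proof -
  from x obtain j where j: "j < m" "x $$ (0,j) \<noteq> 0"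
    by (metis One_nat_def carrier_matD eq_matI index_zero_mat less_Suc0)
  from unit[OF j(2)] obtain d where d: "x $$ (0,j) * d = 1" by (metis dvdE)
  let ?w = "mat m 1 (\<lambda>(i,_). if i = j then d * r $$ (0,0) else 0)"
  have "x * ?w = r"
  proof (rule eq_matI)
    fix i k assume "i < dim_row r" "k < dim_col r"
    then have "i = 0" "k = 0" using r by auto
    then have "(x * ?w) $$ (i,k) = (\<Sum>l = 0..<m. if l = j then x $$ (0,l) * (d * r $$ (0,0)) else 0)"
      using x j by (simp add: scalar_prod_def if_distrib[of "\<lambda>t. _ * t"] cong: if_cong)
    also have "\<dots> = r $$ (i,k)" using j d \<open>i = 0\<close> \<open>k = 0\<close> by (simp flip: mult.assoc)
    finally show "(x * ?w) $$ (i,k) = r $$ (i,k)" .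
  qed (use x r in auto)
  then show ?thesis by (intro bexI[of _ ?w]) auto
qed

lemma mult_column_nonzero:
  fixes B :: "'a :: comm_ring_1 mat"
  assumes B: "B \<in> carrier_mat k m" "B \<noteq> 0\<^sub>m k m"
  shows "\<exists>z \<in> carrier_mat m 1. B * z \<noteq> 0\<^sub>m k 1"
proof -
  from B obtain i j where ij: "i < k" "j < m" "B $$ (i,j) \<noteq> 0"
    by (metis carrier_matD eq_matI index_zero_mat)
  \<comment> \<open>The \<open>j\<close>-th standard basis vector, which picks out column
    \<open>j\<close> of \<open>B\<close>.\<close>
  let ?z = "mat m 1 (\<lambda>(l,_). if l = j then 1 else 0)"
  have "(B * ?z) $$ (i,0) = (\<Sum>l = 0..<m. if l = j then B $$ (i,l) else 0)"
    using B ij by (simp add: scalar_prod_def if_distrib[of "\<lambda>t. _ * t"] cong: if_cong)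
  also have "\<dots> = B $$ (i,j)" using ij by simp
  finally have "(B * ?z) $$ (i,0) \<noteq> 0" using ij by simp
  then have "B * ?z \<noteq> 0\<^sub>m k 1" using ij by auto
  then show ?thesis by (intro bexI[of _ ?z]) auto
qed

lemma scalar_unit_mat:
  fixes a :: "'a :: comm_ring_1 mat"
  assumes unit: "\<And>c :: 'a. c \<noteq> 0 \<Longrightarrow> c dvd 1" and a: "a \<in> carrier_mat 1 1" "a \<noteq> 0\<^sub>m 1 1"
  shows "a \<in> Units (ring_mat TYPE('a) 1 ())"
proof -
  from mult_row_mat_column_solvable[OF unit a, of "1\<^sub>m 1"] obtain b where
    b: "b \<in> carrier_mat 1 1" "a * b = 1\<^sub>m 1" by auto
  moreover have "b * a = a * b"
    using a b(1) by (intro eq_matI) (auto simp: scalar_prod_def mult.commute)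
  ultimately show ?thesis using a by (auto intro: mat_UnitsI)
qed

section \<open>Decomposing nonzero matrices over a field\<close>

text \<open>The decomposition \<open>B = U + N\<close> fixes \<open>U\<close> and its inverse
  \<open>V\<close> before the column \<open>w\<close> is chosen; therefore the last assumption asks
  for a \<open>w\<close> for every unit \<open>V\<close>. The rest \<open>y - w\<close> of the first
  column goes into the nilpotent summand.\<close>

lemma fine_mat_block:
  fixes a x y B :: "'a :: comm_ring_1 mat"
  assumes c: "a \<in> carrier_mat 1 1" "x \<in> carrier_mat 1 m" "y \<in> carrier_mat m 1" "B \<in> carrier_mat m m"
    and fine: "fine_mat m B"
    and z: "\<And>V. V \<in> Units (ring_mat TYPE('a) m ()) \<Longrightarrow>
      \<exists>w \<in> carrier_mat m 1. \<exists>S \<in> Units (ring_mat TYPE('a) 1 ()). a = S + x * V * w"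
  shows "fine_mat (1 + m) (four_block_mat a x y B)"
proof -
  from fine obtain U N where U: "U \<in> Units (ring_mat TYPE('a) m ())"
    and N: "nilpotent_elem (ring_mat TYPE('a) m ()) N" and BUN: "B = U + N"
    unfolding fine_elem_def ring_mat_simps by blast
  from U obtain V where UV: "U \<in> carrier_mat m m" "V \<in> carrier_mat m m" "U * V = 1\<^sub>m m" "V * U = 1\<^sub>m m"
    by (rule mat_UnitsE)
  from N obtain k where Nk: "N \<in> carrier_mat m m" "N ^\<^sub>m k = 0\<^sub>m m m"
    unfolding nilpotent_elem_mat_iff by blast
  from z[OF mat_UnitsI[OF UV(2,1,4,3)]] obtain w S where w: "w \<in> carrier_mat m 1"
    and S: "S \<in> Units (ring_mat TYPE('a) 1 ())" and aS: "a = S + x * V * w" by blast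
  have "four_block_mat a x w U \<in> Units (ring_mat TYPE('a) (1 + m) ())"
    by (rule block_unit[OF c(1,2) w UV S aS])
  moreover have "nilpotent_elem (ring_mat TYPE('a) (1 + m) ()) (four_block_mat (0\<^sub>m 1 1) (0\<^sub>m 1 m) (y - w) N)"
    by (rule block_nilpotent[OF Nk]) (use c w in auto)
  moreover have "four_block_mat a x y B = four_block_mat a x w U + four_block_mat (0\<^sub>m 1 1) (0\<^sub>m 1 m) (y - w) N"
    by (subst add_four_block_mat[of _ 1 1 _ m _ m], insert c w UV Nk BUN,
      auto intro!: cong_four_block_mat eq_matI)
  ultimately show ?thesis unfolding fine_elem_def ring_mat_simps by blast
qed

text \<open>As \<open>V\<close> is invertible, \<open>x * V\<close> is again a nonzero row, so
  \<open>w\<close> can be chosen to make the Schur complement equal to \<open>1\<close>.\<close>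

lemma fine_mat_block_row:
  fixes a x y B :: "'a :: comm_ring_1 mat"
  assumes unit: "\<And>c :: 'a. c \<noteq> 0 \<Longrightarrow> c dvd 1"
    and c: "a \<in> carrier_mat 1 1" "x \<in> carrier_mat 1 m" "y \<in> carrier_mat m 1" "B \<in> carrier_mat m m"
    and fine: "fine_mat m B" and x: "x \<noteq> 0\<^sub>m 1 m"
  shows "fine_mat (1 + m) (four_block_mat a x y B)"
proof (rule fine_mat_block[OF c fine])
  fix V :: "'a mat" assume "V \<in> Units (ring_mat TYPE('a) m ())"
  then obtain U where V: "V \<in> carrier_mat m m" "U \<in> carrier_mat m m" "V * U = 1\<^sub>m m" by (rule mat_UnitsE)
  have "x * V * U = x" using V c by (simp add: assoc_mult_mat[of x 1 m V m U m])
  then have "x * V \<noteq> 0\<^sub>m 1 m" using x V by auto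
  moreover have "x * V \<in> carrier_mat 1 m" "a - 1\<^sub>m 1 \<in> carrier_mat 1 1" using V c by auto
  ultimately obtain w where w: "w \<in> carrier_mat m 1" "x * V * w = a - 1\<^sub>m 1"
    using mult_row_mat_column_solvable[OF unit] by metis
  have "a = 1\<^sub>m 1 + (a - 1\<^sub>m 1)" using c by (intro eq_matI) auto
  moreover have "1\<^sub>m 1 \<in> Units (ring_mat TYPE('a) 1 ())" by (rule mat_UnitsI[of _ _ "1\<^sub>m 1"]) auto
  ultimately show "\<exists>w \<in> carrier_mat m 1. \<exists>S \<in> Units (ring_mat TYPE('a) 1 ()). a = S + x * V * w"
    using w by metis
qed

text \<open>The matrix in \<open>fine\<close> is the conjugate by the lower unitriangular matrix
  with corner \<open>z\<close>. It keeps the upper right block \<open>x\<close>, while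
  \<open>z\<close> can be used to alter the lower blocks.\<close>

lemma fine_mat_block_conj:
  fixes a x y B z :: "'a :: comm_ring_1 mat"
  assumes c: "a \<in> carrier_mat l l" "x \<in> carrier_mat l m" "y \<in> carrier_mat m l" "B \<in> carrier_mat m m"
    and z: "z \<in> carrier_mat m l"
    and fine: "fine_mat (l + m) (four_block_mat (a - x * z) x (z * a + y - (z * x + B) * z) (z * x + B))"
  shows "fine_mat (l + m) (four_block_mat a x y B)"
proof -
  interpret R: ring "ring_mat TYPE('a) (l + m) ()" by (rule ring_mat)
  let ?P = "\<lambda>z :: 'a mat. four_block_mat (1\<^sub>m l) (0\<^sub>m l m) z (1\<^sub>m m)"
  let ?A = "four_block_mat a x y B"
  have PP: "?P s * ?P t = ?P (s + t)" if "s \<in> carrier_mat m l" "t \<in> carrier_mat m l" for s t :: "'a mat"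
    by (subst mult_four_block_mat[of _ l l _ m _ m _ _ l _ m], insert that, auto)
  have P: "?P s \<in> carrier_mat (l + m) (l + m)" if "s \<in> carrier_mat m l" for s :: "'a mat"
    using that by auto
  have A: "?P z * ?A = four_block_mat a x (z * a + y) (z * x + B)"
    by (subst mult_four_block_mat[of _ l l _ m _ m _ _ l _ m], insert c z, auto)
  have za: "z * a + y \<in> carrier_mat m l" and zx: "z * x + B \<in> carrier_mat m m" using z c by auto
  have neg: "Q + W * - z = Q - W * z" if "Q \<in> carrier_mat k l" "W \<in> carrier_mat k m" for k and Q W :: "'a mat"
    using that z by (simp add: minus_add_uminus_mat[of _ k l])
  have "?P z * ?A * ?P (- z) = four_block_mat (a + x * - z) x (z * a + y + (z * x + B) * - z) (z * x + B)"
    unfolding A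
    by (subst mult_four_block_mat[of _ l l _ m _ m _ _ l _ m], insert c z zx za, auto)
  then have "fine_mat (l + m) (?P z * ?A * ?P (- z))"
    using fine neg[OF c(1,2)] neg[OF za zx] by simp
  moreover have "?P z * ?P (- z) = 1\<^sub>m (l + m)" "?P (- z) * ?P z = 1\<^sub>m (l + m)"
    using z by (simp_all add: PP uminus_l_inv_mat uminus_r_inv_mat)
  moreover have "- z \<in> carrier_mat m l" "?A \<in> carrier_mat (l + m) (l + m)" using z c by auto
  ultimately show ?thesis
    using R.fine_elem_conj[of "?P z" "?P (- z)" ?A] P z unfolding ring_mat_simps by blast
qed

text \<open>If the lower right block vanishes, conjugation by a block unitriangular matrix makes it
  nonzero without changing the upper right block.\<close>
lemma fine_mat_block_row_nonzero:
  fixes a x y B :: "'a :: comm_ring_1 mat"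
  assumes unit: "\<And>c :: 'a. c \<noteq> 0 \<Longrightarrow> c dvd 1"
    and IH: "\<And>B :: 'a mat. B \<in> carrier_mat m m \<Longrightarrow> B \<noteq> 0\<^sub>m m m \<Longrightarrow> fine_mat m B"
    and c: "a \<in> carrier_mat 1 1" "x \<in> carrier_mat 1 m" "y \<in> carrier_mat m 1" "B \<in> carrier_mat m m"
    and x: "x \<noteq> 0\<^sub>m 1 m"
  shows "fine_mat (1 + m) (four_block_mat a x y B)"
proof (cases "B = 0\<^sub>m m m")
  case False
  then show ?thesis using fine_mat_block_row[OF unit c IH[OF c(4)] x] by blast
next
  case True
  \<comment> \<open>With \<open>x * z = 1\<close> the new lower right block \<open>z * x\<close>
    satisfies \<open>x * (z * x) = x\<close>, so it is nonzero and the induction hypothesis applies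
    to it.\<close>
  from mult_row_mat_column_solvable[OF unit c(2) x, of "1\<^sub>m 1"] obtain z where
    z: "z \<in> carrier_mat m 1" "x * z = 1\<^sub>m 1" by auto
  have zx: "z * x \<in> carrier_mat m m" using z c by simp
  have "z * x \<noteq> 0\<^sub>m m m"
  proof
    assume "z * x = 0\<^sub>m m m"
    moreover have "x * (z * x) = x" using z c by (metis assoc_mult_mat left_mult_one_mat)
    ultimately show False using c x by simp
  qed
  show ?thesis
    by (rule fine_mat_block_conj[OF c z(1)], rule fine_mat_block_row[OF unit])
      (use c z zx x True IH[OF zx \<open>z * x \<noteq> 0\<^sub>m m m\<close>] \<open>z * x \<noteq> 0\<^sub>m m m\<close> in auto)
qed

lemma fine_mat_block_column_nonzero:
  fixes a x y B :: "'a :: comm_ring_1 mat"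
  assumes unit: "\<And>c :: 'a. c \<noteq> 0 \<Longrightarrow> c dvd 1"
    and IH: "\<And>B :: 'a mat. B \<in> carrier_mat m m \<Longrightarrow> B \<noteq> 0\<^sub>m m m \<Longrightarrow> fine_mat m B"
    and c: "a \<in> carrier_mat 1 1" "x \<in> carrier_mat 1 m" "y \<in> carrier_mat m 1" "B \<in> carrier_mat m m"
    and y: "y \<noteq> 0\<^sub>m m 1"
  shows "fine_mat (1 + m) (four_block_mat a x y B)"
proof (rule fine_mat_transpose)
  have "transpose_mat y \<noteq> 0\<^sub>m 1 m" using y by (metis transpose_transpose zero_transpose_mat)
  then have "fine_mat (1 + m) (four_block_mat (transpose_mat a) (transpose_mat y) (transpose_mat x) (transpose_mat B))"
    by (intro fine_mat_block_row_nonzero[OF unit IH]) (use c in auto)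
  then show "fine_mat (1 + m) (transpose_mat (four_block_mat a x y B))"
    using transpose_four_block_mat[OF c] by simp
qed

text \<open>Beyond a nonzero row or column there remain two cases. If \<open>a\<close> and
  \<open>B\<close> are both nonzero and \<open>x = 0\<close>, the Schur complement is
  \<open>a\<close> itself. If the matrix is block diagonal with exactly one nonzero block, a
  conjugation creates the nonzero column \<open>z * a - B * z\<close>.\<close>

lemma fine_mat_block_nonzero:
  fixes a x y B :: "'a :: comm_ring_1 mat"
  assumes unit: "\<And>c :: 'a. c \<noteq> 0 \<Longrightarrow> c dvd 1"
    and IH: "\<And>B :: 'a mat. B \<in> carrier_mat m m \<Longrightarrow> B \<noteq> 0\<^sub>m m m \<Longrightarrow> fine_mat m B"
    and c: "a \<in> carrier_mat 1 1" "x \<in> carrier_mat 1 m" "y \<in> carrier_mat m 1" "B \<in> carrier_mat m m"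
    and m: "m > 0" and nz: "four_block_mat a x y B \<noteq> 0\<^sub>m (1 + m) (1 + m)"
  shows "fine_mat (1 + m) (four_block_mat a x y B)"
proof -
  consider "x \<noteq> 0\<^sub>m 1 m" | "y \<noteq> 0\<^sub>m m 1" | "a \<noteq> 0\<^sub>m 1 1" "B \<noteq> 0\<^sub>m m m" "x = 0\<^sub>m 1 m"
    | (diag) "x = 0\<^sub>m 1 m" "y = 0\<^sub>m m 1" "a = 0\<^sub>m 1 1 \<or> B = 0\<^sub>m m m" by blast
  then show ?thesis
  proof cases
    case 1
    then show ?thesis by (intro fine_mat_block_row_nonzero[OF unit IH c])
  next
    case 2
    then show ?thesis by (intro fine_mat_block_column_nonzero[OF unit IH c])
  next
    case 3
    show ?thesis
    proof (rule fine_mat_block[OF c IH[OF c(4) 3(2)]])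
      fix V :: "'a mat" assume "V \<in> Units (ring_mat TYPE('a) m ())"
      then have "V \<in> carrier_mat m m" by (rule mat_UnitsE)
      \<comment> \<open>The choice is \<open>w = 0\<close> and \<open>S = a\<close>, a unit because
        it is a nonzero 1 by 1 matrix.\<close>
      then have "a = a + x * V * 0\<^sub>m m 1" using c by auto
      then show "\<exists>w \<in> carrier_mat m 1. \<exists>S \<in> Units (ring_mat TYPE('a) 1 ()). a = S + x * V * w"
        using scalar_unit_mat[OF unit c(1) 3(1)] by (metis zero_carrier_mat)
    qed
  next
    case diag
    have "\<exists>z \<in> carrier_mat m 1. z * a - B * z \<noteq> 0\<^sub>m m 1"
    proof (cases "a = 0\<^sub>m 1 1")
      case True
      with diag nz have "B \<noteq> 0\<^sub>m m m" by auto
      then obtain z where z: "z \<in> carrier_mat m 1" "B * z \<noteq> 0\<^sub>m m 1"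
        using mult_column_nonzero[OF c(4)] by blast
      have "B * z \<in> carrier_mat m 1" using c z by simp
      moreover have "B * z = - (z * a - B * z)" using True c z by (intro eq_matI) auto
      ultimately have "z * a - B * z \<noteq> 0\<^sub>m m 1" using z(2) by (metis uminus_zero_mat)
      then show ?thesis using z by blast
    next
      case False
      with diag have B: "B = 0\<^sub>m m m" by simp
      \<comment> \<open>Since \<open>B = 0\<close>, each entry of \<open>?z * a\<close> is the
        nonzero scalar in \<open>a\<close>; \<open>m > 0\<close> ensures that there is one.\<close>
      let ?z = "mat m 1 (\<lambda>_. 1 :: 'a)"
      have a0: "a $$ (0,0) \<noteq> 0" using False c by (metis One_nat_def carrier_matD eq_matI index_zero_mat less_Suc0)
      have "(?z * a - B * ?z) $$ (0,0) = a $$ (0,0)" using m c B by (auto simp: scalar_prod_def)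
      then have "?z * a - B * ?z \<noteq> 0\<^sub>m m 1" using a0 m by auto
      then show ?thesis by (intro bexI[of _ ?z]) auto
    qed
    then obtain z where z: "z \<in> carrier_mat m 1" "z * a - B * z \<noteq> 0\<^sub>m m 1" by blast
    show ?thesis
    proof (rule fine_mat_block_conj[OF c z(1)], rule fine_mat_block_column_nonzero[OF unit IH])
      have "z * a + y - (z * x + B) * z = z * a - B * z"
        using c z(1) diag by simp
      then show "z * a + y - (z * x + B) * z \<noteq> 0\<^sub>m m 1" using z(2) by simp
    qed (use c z in auto)
  qed
qed

lemma nonzero_mat_is_fine:
  fixes A :: "'a :: comm_ring_1 mat"
  assumes unit: "\<And>c :: 'a. c \<noteq> 0 \<Longrightarrow> c dvd 1"
    and A: "A \<in> carrier_mat n n" "A \<noteq> 0\<^sub>m n n"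
  shows "fine_mat n A"
  using A
proof (induction n arbitrary: A)
  case 0
  then show ?case by auto
next
  case (Suc m)
  show ?case
  \<comment> \<open>Size 1 starts the induction, since the block argument requires
    \<open>m > 0\<close>. There \<open>A\<close> is itself a unit and the nilpotent summand is
    zero.\<close>
  proof (cases "m = 0")
    case True
    then have "A \<in> Units (ring_mat TYPE('a) (Suc m) ())" using scalar_unit_mat[OF unit] Suc.prems by simp
    moreover have "nilpotent_elem (ring_mat TYPE('a) (Suc m) ()) (0\<^sub>m (Suc m) (Suc m))"
      unfolding nilpotent_elem_mat_iff by (auto intro!: exI[of _ 1])
    ultimately show ?thesis using Suc.prems unfolding fine_elem_def ring_mat_simps
      by (metis right_add_zero_mat)
  next
    case False
    obtain a x y B where s: "split_block A 1 1 = (a, x, y, B)" by (metis prod_cases4)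
    note sb = split_block[OF s, of m m]
    have "A = four_block_mat a x y B" "a \<in> carrier_mat 1 1" "x \<in> carrier_mat 1 m"
      "y \<in> carrier_mat m 1" "B \<in> carrier_mat m m"
      using sb Suc.prems by auto
    then show ?thesis using fine_mat_block_nonzero[OF unit Suc.IH, of a x y B] Suc.prems False by simp
  qed
qed

section \<open>Torsion of matrix units over a locally finite field\<close>

lemma finite_carrier_mat_entries:
  assumes "finite K"
  shows "finite {A \<in> carrier_mat n m. \<forall>i<n. \<forall>j<m. A $$ (i,j) \<in> K}"
proof -
  have "finite ((\<lambda>f. mat n m f) ` (\<Pi>\<^sub>E p \<in> {..<n} \<times> {..<m}. K))"
    using assms by (intro finite_imageI finite_PiE) auto
  moreover have "{A \<in> carrier_mat n m. \<forall>i<n. \<forall>j<m. A $$ (i,j) \<in> K}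
    \<subseteq> (\<lambda>f. mat n m f) ` (\<Pi>\<^sub>E p \<in> {..<n} \<times> {..<m}. K)"
  proof
    fix A assume "A \<in> {A \<in> carrier_mat n m. \<forall>i<n. \<forall>j<m. A $$ (i,j) \<in> K}"
    then show "A \<in> (\<lambda>f. mat n m f) ` (\<Pi>\<^sub>E p \<in> {..<n} \<times> {..<m}. K)"
      by (intro image_eqI[of _ _ "restrict (\<lambda>p. A $$ p) ({..<n} \<times> {..<m})"]) (auto intro!: eq_matI)
  qed
  ultimately show ?thesis by (rule rev_finite_subset)
qed

text \<open>By pigeonhole two powers with exponents \<open>i < j\<close> agree; cancelling the unit
  \<open>u [^] i\<close> leaves exponent \<open>j - i\<close>.\<close>

lemma (in monoid) Units_finite_powers_torsion:
  assumes u: "u \<in> Units G" and fin: "finite (range (\<lambda>k::nat. u [^] k))"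
  shows "\<exists>k::nat. k > 0 \<and> u [^] k = \<one>"
proof -
  have "\<not> inj (\<lambda>k::nat. u [^] k)" using fin finite_imageD infinite_UNIV_nat by blast
  then obtain i j :: nat where "u [^] i = u [^] j" "i < j" unfolding inj_def by (metis nat_neq_iff)
  then have "u [^] i \<otimes> u [^] (j - i) = u [^] i \<otimes> \<one>"
    using Units_closed[OF u] nat_pow_mult[of u i "j - i"] by simp
  moreover have "u [^] i \<in> Units G" using u by (rule Units_pow_closed)
  ultimately have "u [^] (j - i) = \<one>" using u by (metis Units_closed Units_l_cancel nat_pow_closed one_closed)
  then show ?thesis using \<open>i < j\<close> by (intro exI[of _ "j - i"]) simp
qed

text \<open>All powers of \<open>U\<close> have entries in the subfield generated by the entries of
  \<open>U\<close>. That subfield is finite, so only finitely many powers are distinct.\<close>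

lemma locally_finite_field_mat_Units_torsion:
  fixes U :: "'a :: comm_ring_1 mat"
  assumes lff: "locally_finite_field (class_ring :: 'a ring)"
    and U: "U \<in> Units (ring_mat TYPE('a) n ())"
  shows "torsion_unit (ring_mat TYPE('a) n ()) U"
proof -
  interpret R: ring "ring_mat TYPE('a) n ()" by (rule ring_mat)
  from U have Uc: "U \<in> carrier_mat n n" by (rule mat_UnitsE)
  define K where "K = generate_field (class_ring :: 'a ring) (elements_mat U)"
  have "finite (elements_mat U)" unfolding elements_mat_def by auto
  then have fin: "finite K" using lff unfolding locally_finite_field_def K_def by simp
  have K1: "1 \<in> K" using generate_field.one[of "class_ring :: 'a ring"] by (simp add: K_def)
  have Kadd: "x + y \<in> K" if "x \<in> K" "y \<in> K" for x y
    using generate_field.eng_add[of x "class_ring :: 'a ring"] that by (simp add: K_def)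
  have Kmult: "x * y \<in> K" if "x \<in> K" "y \<in> K" for x y
    using generate_field.eng_mult[of x "class_ring :: 'a ring"] that by (simp add: K_def)
  \<comment> \<open>This yields \<open>0 = 1 + (- 1)\<close> in \<open>K\<close>, which serves the
    empty sum and the off-diagonal entries of the zeroth power.\<close>
  have "- 1 \<in> K" using generate_field.a_inv[of 1 "class_ring :: 'a ring"] K1
    by (simp add: K_def class_ring_simps)
  then have K0: "0 \<in> K" using Kadd[OF K1] by fastforce
  have Ksum: "sum f A \<in> K" if "\<And>i. i \<in> A \<Longrightarrow> f i \<in> K" for f :: "nat \<Rightarrow> 'a" and A
    using that by (induction A rule: infinite_finite_induct) (auto simp: K0 Kadd)
  have KU: "U $$ (i,j) \<in> K" if "i < n" "j < n" for i j
    unfolding K_def by (rule generate_field.incl, rule elements_matI[OF Uc that refl])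
  have pow: "U ^\<^sub>m k \<in> {A \<in> carrier_mat n n. \<forall>i<n. \<forall>j<n. A $$ (i,j) \<in> K}" for k
  proof (induction k)
    case (Suc k)
    then show ?case using Uc
      by (auto simp: scalar_prod_def intro!: Ksum Kmult KU)
  qed (use Uc K0 K1 in auto)
  have "finite (range (\<lambda>k. U ^\<^sub>m k))"
    by (rule finite_subset[OF _ finite_carrier_mat_entries[OF fin]]) (use pow in blast)
  then have "finite (range (\<lambda>k::nat. U [^]\<^bsub>ring_mat TYPE('a) n ()\<^esub> k))"
    by (simp only: pow_mat_ring_pow[OF Uc, where b = "()"])
  then show ?thesis using R.Units_finite_powers_torsion[OF U] U unfolding torsion_unit_def by blast
qed

(* The sort comm_ring_1 includes 0 \<noteq> 1, so 'a ranges over the non-zero commutative rings;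
   class_ring is that ring as a HOL-Algebra record. *)
theorem corollary5p4:
  fixes n :: nat
  assumes "n > 0"
  shows "t_fine_ring (ring_mat TYPE('a::comm_ring_1) n ()) \<longleftrightarrow>
         locally_finite_field (class_ring :: 'a ring)"
proof
  assume "t_fine_ring (ring_mat TYPE('a) n ())"
  then show "locally_finite_field (class_ring :: 'a ring)"
    by (intro roots_of_unity_imp_locally_finite_field roots_of_unity_mod_nilpotents_imp_roots_of_unity
      t_fine_ring_mat_imp_root_of_unity_mod_nilpotents[OF assms])
next
  assume lff: "locally_finite_field (class_ring :: 'a ring)"
  then interpret F: field "class_ring :: 'a ring" unfolding locally_finite_field_def by blast
  have unit: "c dvd 1" if "c \<noteq> 0" for c :: 'a
  proof -
    have "c \<in> Units (class_ring :: 'a ring)" using that F.field_Units by simp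
    then obtain d where "c * d = 1" unfolding Units_def by auto
    then show ?thesis by (metis dvd_triv_left)
  qed
  show "t_fine_ring (ring_mat TYPE('a) n ())"
    unfolding t_fine_ring_def
  proof (intro conjI ballI impI)
    fix A assume "A \<in> carrier (ring_mat TYPE('a) n ())" "A \<noteq> \<zero>\<^bsub>ring_mat TYPE('a) n ()\<^esub>"
    then have "fine_mat n A" using nonzero_mat_is_fine[OF unit] unfolding ring_mat_simps by blast
    then show "\<exists>u b. torsion_unit (ring_mat TYPE('a) n ()) u \<and> nilpotent_elem (ring_mat TYPE('a) n ()) b \<and>
        A = u \<oplus>\<^bsub>ring_mat TYPE('a) n ()\<^esub> b"
      using locally_finite_field_mat_Units_torsion[OF lff] unfolding fine_elem_def by blast
  qed (rule ring_mat)
qed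

end
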